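(* Let $G$ be a regression graph with node set $N=(u,v)$. If $G$ contains a chordless collision path in four distinct nodes, or a chordless cycle in $n\ge 4$ nodes within $v$, then $G$ is not Markov equivalent to any directed acyclic graph with the same node set $N$.
   Context: Summary graph. A graph on a finite node set $N$ with an ordered partition $N=(u,v)$ (one part may be empty) and three kinds of edges: arrows $i\leftarrow k$, dashed lines $i\,\text{- -}\,k$, and full lines $i\,\text{---}\,k$. Within $u$ the graph consists of a directed acyclic graph (arrows) together with a covariance graph (dashed lines); a pair in $u$ may be coupled by an arrow, a dashed line, or both. Within $v$ there are only full lines (a concentration graph). Between $u$ and $v$ there are only arrows, pointing from $v$ to $u$. There are no loops. Regression graph. A summary graph without semi-directed cycles. A semi-directed cycle is a direction-preserving cycle (one that contains arrows, all pointing in the same direction along the cycle) containing at least one undirected edge; in particular a pair coupled by both an arrow and a dashed line forms a semi-directed cycle, so in a regression graph each pair is coupled by at most one edge. Paths. A path connects its endpoints by a sequence of edges with distinct inner nodes; a single edge is a path without inner nodes; a path with coinciding endpoints is a cycle. An inner node $j$ of a path, with adjacent path edges to $i$ and $k$, is a collision node if the two edges are $i\to j\leftarrow k$, or $i\to j\,\text{- -}\,k$ (or its mirror image), or $i\,\text{- -}\,j\,\text{- -}\,k$; otherwise it is a transmitting node. A collision path is a path all of whose inner nodes are collision nodes. A $\mathsf V$ is a subgraph induced by three nodes that has exactly two edges. A path is chordless if each inner node forms a $\mathsf V$ with its two neighbours on the path (for a cycle: every node of the cycle forms a $\mathsf V$ with its two neighbours on the cycle). Thus the possible collision paths in four nodes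 are, up to mirror image, $\circ\to\circ\,\text{- -}\,\circ\leftarrow\circ$, $\;\circ\,\text{- -}\,\circ\,\text{- -}\,\circ\leftarrow\circ$, $\;\circ\,\text{- -}\,\circ\,\text{- -}\,\circ\,\text{- -}\,\circ$. Independence structure. $k$ is an ancestor of $i$ (and $i$ a descendant of $k$) if there is a directed path of arrows from $k$ all pointing towards $i$. For pairwise disjoint $\alpha,\beta,c\subseteq N$ with $\alpha,\beta\ne\varnothing$, a summary graph implies $\alpha\perp\!\!\!\perp\beta\mid c$ if and only if there is no path between a node of $\alpha$ and a node of $\beta$ such that every inner collision node is in $c$ or has a descendant in $c$ and every other inner node is outside $c$. A directed acyclic graph is the special case with arrows only (for which this is $d$-separation). The independence structure of a graph is the set of all independence statements it implies. Two graphs on the same node set are Markov equivalent if they capture the same independence structure. *)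

theory Defs
  imports Main
begin

text \<open>The pair \<open>(k, i) \<in> arrows G\<close> is the arrow from \<open>k\<close> to \<open>i\<close>; undirected edges are
  two-element sets. A pair of nodes may carry an arrow and a dashed line at the same time.\<close>

record 'a summary_graph =
  part_u :: "'a set"
  part_v :: "'a set"
  arrows :: "('a \<times> 'a) set"
  dashed :: "'a set set"
  full :: "'a set set"

definition nodes :: "'a summary_graph \<Rightarrow> 'a set" where
  "nodes G = part_u G \<union> part_v G"

definition summary_graph :: "'a summary_graph \<Rightarrow> bool" where
  "summary_graph G \<longleftrightarrow>
     finite (nodes G) \<and> part_u G \<inter> part_v G = {} \<and>
     arrows G \<subseteq> (part_u G \<times> part_u G) \<union> (part_v G \<times> part_u G) \<and>
     acyclic (arrows G \<inter> part_u G \<times> part_u G) \<and>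
     (\<forall>e \<in> dashed G. e \<subseteq> part_u G \<and> card e = 2) \<and>
     (\<forall>e \<in> full G. e \<subseteq> part_v G \<and> card e = 2)"

text \<open>The kind of an edge as it is met when walking along a path: an arrow may be
  traversed along (\<open>Fwd\<close>) or against (\<open>Bwd\<close>) its direction.\<close>

datatype step = Fwd | Bwd | Dash | Line

fun has_step :: "'a summary_graph \<Rightarrow> 'a \<Rightarrow> step \<Rightarrow> 'a \<Rightarrow> bool" where
  "has_step G x Fwd y \<longleftrightarrow> (x, y) \<in> arrows G"
| "has_step G x Bwd y \<longleftrightarrow> (y, x) \<in> arrows G"
| "has_step G x Dash y \<longleftrightarrow> {x, y} \<in> dashed G"
| "has_step G x Line y \<longleftrightarrow> {x, y} \<in> full G"

text \<open>A path is given by its nodes \<open>ns\<close> and the edges \<open>ks\<close> between consecutive nodes, since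
  the nodes alone do not determine the edges in the presence of double edges. The two
  distinctness conditions say that nodes are not repeated, except that the first and the last
  one may coincide. A single edge run through back and forth counts as a cycle on two nodes;
  this affects neither semi-directed cycles (which have edges of two kinds) nor cycles on
  at least three nodes.\<close>

definition is_path :: "'a summary_graph \<Rightarrow> 'a list \<Rightarrow> step list \<Rightarrow> bool" where
  "is_path G ns ks \<longleftrightarrow>
     ks \<noteq> [] \<and> length ns = Suc (length ks) \<and>
     (\<forall>i < length ks. has_step G (ns ! i) (ks ! i) (ns ! Suc i)) \<and>
     distinct (butlast ns) \<and> distinct (tl ns)"

definition is_cycle :: "'a summary_graph \<Rightarrow> 'a list \<Rightarrow> step list \<Rightarrow> bool" where
  "is_cycle G ns ks \<longleftrightarrow> is_path G ns ks \<and> hd ns = last ns"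

text \<open>It suffices to mention \<open>Fwd\<close> in the next definition, since a cycle can be run through
  in the reverse direction.\<close>

definition semi_directed_cycle :: "'a summary_graph \<Rightarrow> 'a list \<Rightarrow> step list \<Rightarrow> bool" where
  "semi_directed_cycle G ns ks \<longleftrightarrow>
     is_cycle G ns ks \<and> Fwd \<in> set ks \<and> Bwd \<notin> set ks \<and> (Dash \<in> set ks \<or> Line \<in> set ks)"

definition regression_graph :: "'a summary_graph \<Rightarrow> bool" where
  "regression_graph G \<longleftrightarrow> summary_graph G \<and> (\<nexists>ns ks. semi_directed_cycle G ns ks)"

definition directed_acyclic_graph :: "'a summary_graph \<Rightarrow> bool" where
  "directed_acyclic_graph G \<longleftrightarrow> summary_graph G \<and> dashed G = {} \<and> full G = {}"

text \<open>The inner nodes of a path are the \<open>ns ! j\<close> with \<open>0 < j < length ks\<close>; the edges meeting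
  at \<open>ns ! j\<close> are \<open>ks ! (j - 1)\<close> and \<open>ks ! j\<close>.\<close>

definition collision_at :: "step list \<Rightarrow> nat \<Rightarrow> bool" where
  "collision_at ks j \<longleftrightarrow> ks ! (j - 1) \<in> {Fwd, Dash} \<and> ks ! j \<in> {Bwd, Dash}"

definition collision_path :: "'a summary_graph \<Rightarrow> 'a list \<Rightarrow> step list \<Rightarrow> bool" where
  "collision_path G ns ks \<longleftrightarrow>
     is_path G ns ks \<and> (\<forall>j \<in> {0<..<length ks}. collision_at ks j)"

definition edges_within :: "'a summary_graph \<Rightarrow> 'a set \<Rightarrow> nat" where
  "edges_within G S =
     card (arrows G \<inter> S \<times> S) + card (dashed G \<inter> Pow S) + card (full G \<inter> Pow S)"

definition forms_V :: "'a summary_graph \<Rightarrow> 'a \<Rightarrow> 'a \<Rightarrow> 'a \<Rightarrow> bool" where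
  "forms_V G i j k \<longleftrightarrow>
     {i, j, k} \<subseteq> nodes G \<and> card {i, j, k} = 3 \<and> edges_within G {i, j, k} = 2"

definition chordless_path :: "'a summary_graph \<Rightarrow> 'a list \<Rightarrow> step list \<Rightarrow> bool" where
  "chordless_path G ns ks \<longleftrightarrow>
     is_path G ns ks \<and>
     (\<forall>j \<in> {0<..<length ks}. forms_V G (ns ! (j - 1)) (ns ! j) (ns ! Suc j))"

text \<open>In a cycle, the last conjunct treats the node \<open>ns ! 0 = ns ! length ks\<close>.\<close>

definition chordless_cycle :: "'a summary_graph \<Rightarrow> 'a list \<Rightarrow> step list \<Rightarrow> bool" where
  "chordless_cycle G ns ks \<longleftrightarrow>
     is_cycle G ns ks \<and> chordless_path G ns ks \<and>
     forms_V G (ns ! (length ks - 1)) (ns ! 0) (ns ! 1)"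

definition descendants :: "'a summary_graph \<Rightarrow> 'a \<Rightarrow> 'a set" where
  "descendants G k = {i. (k, i) \<in> (arrows G)\<^sup>+}"

definition active_path :: "'a summary_graph \<Rightarrow> 'a set \<Rightarrow> 'a list \<Rightarrow> step list \<Rightarrow> bool" where
  "active_path G c ns ks \<longleftrightarrow>
     is_path G ns ks \<and>
     (\<forall>j \<in> {0<..<length ks}.
        if collision_at ks j then ns ! j \<in> c \<or> descendants G (ns ! j) \<inter> c \<noteq> {}
        else ns ! j \<notin> c)"

text \<open>The triple \<open>(\<alpha>, \<beta>, c)\<close> stands for the independence of \<open>\<alpha>\<close> and \<open>\<beta>\<close> given \<open>c\<close>.\<close>

definition independence_structure ::
    "'a summary_graph \<Rightarrow> ('a set \<times> 'a set \<times> 'a set) set" where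
  "independence_structure G =
     {(\<alpha>, \<beta>, c). \<alpha> \<union> \<beta> \<union> c \<subseteq> nodes G \<and> \<alpha> \<noteq> {} \<and> \<beta> \<noteq> {} \<and>
        \<alpha> \<inter> \<beta> = {} \<and> \<alpha> \<inter> c = {} \<and> \<beta> \<inter> c = {} \<and>
        (\<nexists>ns ks. active_path G c ns ks \<and> hd ns \<in> \<alpha> \<and> last ns \<in> \<beta>)}"

definition markov_equivalent :: "'a summary_graph \<Rightarrow> 'a summary_graph \<Rightarrow> bool" where
  "markov_equivalent G H \<longleftrightarrow>
     nodes G = nodes H \<and> independence_structure G = independence_structure H"

end

theory Submission
  imports Defs
begin

text \<open>In a regression graph, let \<open>a\<close> and \<open>k\<close> be nonadjacent nodes such that no
  direction-preserving path with at least one arrow leads from \<open>k\<close> to \<open>a\<close>. Then \<open>a\<close> and \<open>k\<close>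
  are separated by the nodes from which such a path leads to \<open>k\<close>, together with \<open>v\<close>. Hence Markov
  equivalent regression graphs have the same adjacencies. The inner node of a collision \<open>V\<close>
  ending in a dashed line lies outside that separating set, so the \<open>V\<close> is a collision in every
  Markov equivalent directed acyclic graph, and a chordless collision path in four nodes would
  force its middle edge to point in both directions. A \<open>V\<close> of full lines, on the other hand, must
  stay transmitting, whereas every cycle in the skeleton of an acyclic graph has a sink.\<close>

section \<open>Adjacency, direction-preserving walks and separating sets\<close>

definition adjacent :: "'a summary_graph \<Rightarrow> 'a \<Rightarrow> 'a \<Rightarrow> bool" where
  "adjacent G x y \<longleftrightarrow> (\<exists>k. has_step G x k y)"

definition forward :: "'a summary_graph \<Rightarrow> ('a \<times> 'a) set" where
  "forward G = {(x, y). \<exists>k. k \<noteq> Bwd \<and> has_step G x k y}"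

text \<open>Built from walks instead of paths, so that walks compose by plain transitivity; the
  passage to paths with distinct nodes happens once, in \<open>forward_rtrancl_path\<close>.\<close>

definition strictly_before :: "'a summary_graph \<Rightarrow> ('a \<times> 'a) set" where
  "strictly_before G = (forward G)\<^sup>* O arrows G O (forward G)\<^sup>*"

text \<open>Only predecessors of \<open>k\<close> enter, so the set is not symmetric in its
  arguments. Adding v blocks every path that leaves \<open>k\<close> by a full line; for
  \<open>k\<close> in v nothing is strictly before \<open>k\<close>, since a walk that has used an
  arrow stays in u.\<close>

definition separator :: "'a summary_graph \<Rightarrow> 'a \<Rightarrow> 'a \<Rightarrow> 'a set" where
  "separator G k a = {x. (x, k) \<in> strictly_before G} \<union> part_v G - {a, k}"

lemma forwardI: "has_step G x k y \<Longrightarrow> k \<noteq> Bwd \<Longrightarrow> (x, y) \<in> forward G"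
  by (auto simp: forward_def)

lemma arrows_subset_forward: "arrows G \<subseteq> forward G"
  by (auto intro: forwardI[where k = Fwd])

lemma adjacent_sym: "adjacent G x y \<Longrightarrow> adjacent G y x"
  unfolding adjacent_def
proof (elim exE)
  fix k assume "has_step G x k y"
  then show "\<exists>k. has_step G y k x"
    by (cases k) (auto simp: insert_commute intro: exI[of _ Fwd] exI[of _ Bwd] exI[of _ Dash] exI[of _ Line])
qed

lemma summary_graphD:
  assumes "summary_graph G"
  shows "finite (nodes G)" "part_u G \<inter> part_v G = {}"
    "(x, y) \<in> arrows G \<Longrightarrow> x \<in> nodes G" "(x, y) \<in> arrows G \<Longrightarrow> y \<in> part_u G"
    "{x, y} \<in> dashed G \<Longrightarrow> x \<in> part_u G" "{x, y} \<in> dashed G \<Longrightarrow> y \<in> part_u G"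
    "{x, y} \<in> full G \<Longrightarrow> x \<in> part_v G" "{x, y} \<in> full G \<Longrightarrow> y \<in> part_v G"
  using assms unfolding summary_graph_def nodes_def by blast+

text \<open>Acyclicity is postulated inside u only, but every node on a directed cycle receives an
  arrow and therefore lies in u.\<close>

lemma acyclic_arrows:
  assumes "summary_graph G"
  shows "acyclic (arrows G)"
proof (rule acyclicI, intro allI notI)
  fix x assume loop: "(x, x) \<in> (arrows G)\<^sup>+"
  then have "x \<in> part_u G"
    by (metis assms summary_graphD(4) tranclD2)
  have "(x, y) \<in> (arrows G \<inter> part_u G \<times> part_u G)\<^sup>+ \<and> y \<in> part_u G"
    if "(x, y) \<in> (arrows G)\<^sup>+" for y
    using that
  proof (induction rule: trancl_induct)
    case (base y)
    then show ?case using \<open>x \<in> part_u G\<close> summary_graphD(4)[OF assms] by blast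
  next
    case (step y z)
    then have "(y, z) \<in> arrows G \<inter> part_u G \<times> part_u G"
      using summary_graphD(4)[OF assms] by blast
    then show ?case using step.IH by (meson IntD2 SigmaD2 trancl.trancl_into_trancl)
  qed
  with loop have "(x, x) \<in> (arrows G \<inter> part_u G \<times> part_u G)\<^sup>+" by blast
  then show False
    using assms by (auto simp: summary_graph_def acyclic_def)
qed

section \<open>Walks and paths in regression graphs\<close>

lemma rtrancl_nth:
  assumes "\<And>i. m \<le> i \<Longrightarrow> i < n \<Longrightarrow> (xs ! i, xs ! Suc i) \<in> r" "m \<le> n"
  shows "(xs ! m, xs ! n) \<in> r\<^sup>*"
  using assms(2,1)
proof (induction n rule: dec_induct)
  case (step n)
  then show ?case by (metis less_Suc_eq rtrancl.rtrancl_into_rtrancl)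
qed simp

text \<open>A walk is shortened from its front: if the new start already occurs on the path found so
  far, the part before that occurrence is dropped. The list \<open>ks\<close> may be empty, so this
  is not yet an instance of \<open>is_path\<close>.\<close>

lemma forward_rtrancl_path:
  assumes "(y, x) \<in> (forward G)\<^sup>*"
  shows "\<exists>ns ks. length ns = Suc (length ks) \<and> hd ns = y \<and> last ns = x \<and> distinct ns \<and>
    (\<forall>i < length ks. has_step G (ns ! i) (ks ! i) (ns ! Suc i)) \<and> Bwd \<notin> set ks"
  using assms
proof (induction rule: converse_rtrancl_induct)
  case base
  show ?case by (intro exI[of _ "[x]"] exI[of _ "[]"]) simp
next
  case (step y z)
  then obtain ns ks where p: "length ns = Suc (length ks)" "hd ns = z" "last ns = x" "distinct ns"
    "\<forall>i < length ks. has_step G (ns ! i) (ks ! i) (ns ! Suc i)" "Bwd \<notin> set ks"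
    by blast
  from step.hyps(1) obtain k where k: "k \<noteq> Bwd" "has_step G y k z"
    by (auto simp: forward_def)
  show ?case
  proof (cases "y \<in> set ns")
    case True
    then obtain i where i: "i < length ns" "ns ! i = y"
      by (auto simp: in_set_conv_nth)
    show ?thesis
      using p i
      by (intro exI[of _ "drop i ns"] exI[of _ "drop i ks"])
        (auto simp: hd_drop_conv_nth dest: in_set_dropD)
  next
    case False
    have "has_step G ((y # ns) ! i) ((k # ks) ! i) ((y # ns) ! Suc i)"
      if "i < length (k # ks)" for i
    proof (cases i)
      case 0
      then show ?thesis using k p(1,2) by (cases ns) auto
    next
      case (Suc j)
      then show ?thesis using p(5) that by simp
    qed
    then show ?thesis
      using p k False
      by (intro exI[of _ "y # ns"] exI[of _ "k # ks"]) auto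
  qed
qed

text \<open>A return walk, cut down to a path, closes with the arrow to a cycle without
  \<open>Bwd\<close>. Having no semi-directed cycles rules out undirected edges on it, so it is a
  directed cycle, against acyclicity.\<close>

lemma regression_graph_no_return:
  assumes "regression_graph G" "(x, y) \<in> arrows G"
  shows "(y, x) \<notin> (forward G)\<^sup>*"
proof
  assume "(y, x) \<in> (forward G)\<^sup>*"
  then obtain ns ks where p: "length ns = Suc (length ks)" "hd ns = y" "last ns = x" "distinct ns"
    "\<forall>i < length ks. has_step G (ns ! i) (ks ! i) (ns ! Suc i)" "Bwd \<notin> set ks"
    using forward_rtrancl_path by meson
  from assms have G: "summary_graph G" by (simp add: regression_graph_def)
  have "ns \<noteq> []" using p(1) by auto
  have steps: "has_step G ((x # ns) ! i) ((Fwd # ks) ! i) ((x # ns) ! Suc i)"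
    if "i < length (Fwd # ks)" for i
  proof (cases i)
    case 0
    then show ?thesis using p(2) assms(2) \<open>ns \<noteq> []\<close> by (simp add: hd_conv_nth)
  next
    case (Suc j)
    then show ?thesis using p(5) that by simp
  qed
  \<comment> \<open>The repeated node \<open>x\<close> stands at both ends, and
    \<open>butlast\<close> removes one copy.\<close>
  have "distinct (butlast (x # ns))"
    using p(3,4) \<open>ns \<noteq> []\<close> by (cases ns rule: rev_cases) auto
  then have "is_cycle G (x # ns) (Fwd # ks)"
    using p(1,3,4) \<open>ns \<noteq> []\<close> steps unfolding is_cycle_def is_path_def by auto
  then have "Dash \<notin> set ks" "Line \<notin> set ks"
    using assms(1) p(6) unfolding regression_graph_def semi_directed_cycle_def
    by (metis list.set_intros set_ConsD step.distinct(1))+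
  then have "ks ! i = Fwd" if "i < length ks" for i
    using p(6) that by (metis nth_mem step.exhaust)
  then have "(ns ! 0, ns ! length ks) \<in> (arrows G)\<^sup>*"
    using p(5) by (intro rtrancl_nth) (metis has_step.simps(1), simp)
  then have "(y, x) \<in> (arrows G)\<^sup>*"
    using p(1-3) \<open>ns \<noteq> []\<close> by (simp add: hd_conv_nth last_conv_nth)
  with assms(2) have "(x, x) \<in> (arrows G)\<^sup>+" by (rule rtrancl_into_trancl2)
  with acyclic_arrows[OF G] show False by (simp add: acyclic_def)
qed

text \<open>Makes the separators available on both sides of a Markov equivalence.\<close>

lemma directed_acyclic_graph_regression:
  assumes "directed_acyclic_graph D"
  shows "regression_graph D"
proof -
  have "k \<noteq> Dash \<and> k \<noteq> Line" if "has_step D x k y" for x k y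
    using assms that by (cases k) (auto simp: directed_acyclic_graph_def)
  then have "Dash \<notin> set ks \<and> Line \<notin> set ks" if "is_path D ns ks" for ns ks
    using that unfolding is_path_def by (metis in_set_conv_nth)
  with assms show ?thesis
    by (auto simp: regression_graph_def directed_acyclic_graph_def semi_directed_cycle_def
        is_cycle_def)
qed

lemma strictly_before_not_after:
  assumes "regression_graph G" "(x, y) \<in> strictly_before G"
  shows "(y, x) \<notin> (forward G)\<^sup>*"
proof
  assume "(y, x) \<in> (forward G)\<^sup>*"
  moreover obtain p q where "(x, p) \<in> (forward G)\<^sup>*" "(p, q) \<in> arrows G" "(q, y) \<in> (forward G)\<^sup>*"
    using assms(2) by (auto simp: strictly_before_def)
  ultimately show False
    using regression_graph_no_return[OF assms(1)] by (meson rtrancl_trans)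
qed

lemma strictly_beforeD: "(x, y) \<in> strictly_before G \<Longrightarrow> (x, y) \<in> (forward G)\<^sup>*"
  unfolding strictly_before_def using arrows_subset_forward
  by (blast intro: rtrancl_trans converse_rtrancl_into_rtrancl)

section \<open>Separation of nonadjacent nodes\<close>

lemma strictly_before_nodes:
  assumes "summary_graph G" "(x, y) \<in> strictly_before G"
  shows "x \<in> nodes G"
proof -
  obtain p q where "(x, p) \<in> (forward G)\<^sup>*" "(p, q) \<in> arrows G"
    using assms(2) by (auto simp: strictly_before_def)
  then show ?thesis
  proof (induction rule: converse_rtrancl_induct)
    case base
    then show ?case by (rule summary_graphD(3)[OF assms(1)])
  next
    case (step y z)
    then obtain k where "k \<noteq> Bwd" "has_step G y k z" by (auto simp: forward_def)
    then show ?case using summary_graphD[OF assms(1)] by (cases k) (auto simp: nodes_def)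
  qed
qed

text \<open>Follow an active path from \<open>k\<close>. It must leave by an arrow or a dashed line
  and, as \<open>k\<close> is not strictly before \<open>a\<close>, it must reach a collision node.
  Up to the first one all steps are forward, so a member of the separator at or below that node is
  reached from \<open>k\<close>; yet being in u it is strictly before \<open>k\<close>, which is
  impossible.\<close>

lemma separator_blocks:
  assumes G: "regression_graph G"
    and nadj: "\<not> adjacent G k a" and nbefore: "(k, a) \<notin> strictly_before G"
    and act: "active_path G (separator G k a) ns ks" and ends: "hd ns = k" "last ns = a"
  shows False
proof -
  let ?n = "length ks"
  from G have S: "summary_graph G" by (simp add: regression_graph_def)
  from act have "ks \<noteq> []" and len: "length ns = Suc ?n"
    and steps: "\<And>i. i < ?n \<Longrightarrow> has_step G (ns ! i) (ks ! i) (ns ! Suc i)"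
    and dist: "distinct (butlast ns)" "distinct (tl ns)"
    and inner: "\<And>j. 0 < j \<Longrightarrow> j < ?n \<Longrightarrow>
      if collision_at ks j then ns ! j \<in> separator G k a \<or> descendants G (ns ! j) \<inter> separator G k a \<noteq> {}
      else ns ! j \<notin> separator G k a"
    by (auto simp: active_path_def is_path_def)
  have "ns \<noteq> []" using len by auto
  then have k: "ns ! 0 = k" and a: "ns ! ?n = a"
    using ends len by (auto simp: hd_conv_nth last_conv_nth)
  have "?n \<noteq> 1" using nadj steps[of 0] k a unfolding adjacent_def
    by (metis One_nat_def zero_less_one)
  with \<open>ks \<noteq> []\<close> have n: "1 < ?n" by (cases ks) auto
  \<comment> \<open>\<open>is_path\<close> allows coinciding ends, so the first inner node is
    compared with \<open>k\<close> through \<open>butlast\<close> and with \<open>a\<close> through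
    \<open>tl\<close>.\<close>
  have "ns ! 1 \<noteq> k"
    using dist(1) n len k by (metis One_nat_def diff_Suc_1 length_butlast less_trans
        nth_butlast nth_eq_iff_index_eq zero_less_one zero_neq_one)
  moreover have "ns ! 1 \<noteq> a"
    using nth_eq_iff_index_eq[OF dist(2), of 0 "?n - 1"] n len a \<open>ks \<noteq> []\<close> by (simp add: nth_tl)
  ultimately have sep1: "ns ! 1 \<in> separator G k a"
    if "(ns ! 1, k) \<in> strictly_before G \<or> ns ! 1 \<in> part_v G"
    using that by (auto simp: separator_def)
  have step0: "has_step G k (ks ! 0) (ns ! 1)" using steps[of 0] \<open>ks \<noteq> []\<close> k by simp
  \<comment> \<open>With any other first edge, \<open>ns ! 1\<close> is transmitting and in the
    separator, which blocks the path.\<close>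
  have first: "ks ! 0 = Fwd \<or> ks ! 0 = Dash"
  proof (cases "ks ! 0")
    case Bwd
    then have "(ns ! 1, k) \<in> strictly_before G" using step0 by (auto simp: strictly_before_def)
    then show ?thesis using sep1 inner[of 1] n Bwd by (auto simp: collision_at_def)
  next
    case Line
    then have "ns ! 1 \<in> part_v G" using step0 summary_graphD[OF S] by auto
    then show ?thesis using sep1 inner[of 1] n Line by (auto simp: collision_at_def)
  qed auto
  \<comment> \<open>Otherwise all edges after the first, at least one of them, are arrows towards
    \<open>a\<close>, and \<open>k\<close> is strictly before \<open>a\<close>.\<close>
  have "\<exists>m. 1 \<le> m \<and> m < ?n \<and> ks ! m \<noteq> Fwd"
  proof (rule ccontr)
    assume "\<nexists>m. 1 \<le> m \<and> m < ?n \<and> ks ! m \<noteq> Fwd"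
    then have arr: "(ns ! i, ns ! Suc i) \<in> arrows G" if "1 \<le> i" "i < ?n" for i
      using steps[of i] that by auto
    then have "(ns ! 2, ns ! ?n) \<in> (forward G)\<^sup>*"
      using n arrows_subset_forward[of G] by (intro rtrancl_nth) auto
    moreover have "(ns ! 1, ns ! 2) \<in> arrows G" using arr[of 1] n by (simp add: numeral_2_eq_2)
    moreover have "(k, ns ! 1) \<in> (forward G)\<^sup>*"
      using forwardI[OF step0] first by auto
    ultimately show False using nbefore a by (auto simp: strictly_before_def)
  qed
  \<comment> \<open>Minimality of \<open>m\<close> makes \<open>ns ! m\<close> the first collision
    node, as shown below.\<close>
  then obtain m where m: "1 \<le> m" "m < ?n" "ks ! m \<noteq> Fwd"
    and least: "\<And>i. i < m \<Longrightarrow> 1 \<le> i \<Longrightarrow> ks ! i = Fwd"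
    using exists_least_iff[of "\<lambda>m. 1 \<le> m \<and> m < ?n \<and> ks ! m \<noteq> Fwd"] by (metis less_trans)
  have heads: "ks ! i = Fwd \<or> ks ! i = Dash" if "i < m" for i
    using first least[of i] that by (cases i) auto
  have "(ns ! 0, ns ! m) \<in> (forward G)\<^sup>*"
    using steps heads m by (intro rtrancl_nth) (metis forwardI less_trans step.distinct(1,7), simp)
  then have before: "(k, ns ! m) \<in> (forward G)\<^sup>*" using k by simp
  \<comment> \<open>The path enters \<open>ns ! m\<close> by an arrowhead or a dashed line; being in
    u excludes a full line as the next edge.\<close>
  have u: "ns ! m \<in> part_u G"
  proof -
    have "has_step G (ns ! (m - 1)) (ks ! (m - 1)) (ns ! m)" using steps[of "m - 1"] m by simp
    then show ?thesis using heads[of "m - 1"] m summary_graphD(4,6)[OF S] by auto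
  qed
  have "ks ! m \<noteq> Line"
    using steps[of m] m u summary_graphD[OF S] by auto
  then have "collision_at ks m"
    using heads[of "m - 1"] m by (cases "ks ! m") (auto simp: collision_at_def)
  then obtain w where w: "w \<in> separator G k a" "w = ns ! m \<or> w \<in> descendants G (ns ! m)"
    using inner[of m] m by auto
  have "(ns ! m, w) \<in> (arrows G)\<^sup>*"
    using w(2) by (auto simp: descendants_def)
  then have "(k, w) \<in> (forward G)\<^sup>*"
    using before rtrancl_mono[OF arrows_subset_forward[of G]] by (meson rtrancl_trans subsetD)
  \<comment> \<open>Hence \<open>w\<close> is in the separator as a predecessor of \<open>k\<close>
    and not as a node of v.\<close>
  moreover have "w \<in> part_u G"
    using w(2) u summary_graphD(4)[OF S] by (auto simp: descendants_def dest: tranclD2)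
  then have "(w, k) \<in> strictly_before G"
    using w(1) summary_graphD(2)[OF S] by (auto simp: separator_def)
  ultimately show False using strictly_before_not_after[OF G] by blast
qed

lemma separator_independence:
  assumes "regression_graph G" "k \<in> nodes G" "a \<in> nodes G" "k \<noteq> a"
    and "\<not> adjacent G k a" "(k, a) \<notin> strictly_before G"
  shows "({k}, {a}, separator G k a) \<in> independence_structure G"
proof -
  have "separator G k a \<subseteq> nodes G"
    using assms(1) strictly_before_nodes[of G] by (auto simp: separator_def nodes_def regression_graph_def)
  moreover have "k \<notin> separator G k a" "a \<notin> separator G k a"
    by (auto simp: separator_def)
  moreover have "\<nexists>ns ks. active_path G (separator G k a) ns ks \<and> hd ns \<in> {k} \<and> last ns \<in> {a}"
    using separator_blocks[OF assms(1,5,6)] by auto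
  ultimately show ?thesis
    using assms(2-4) by (simp add: independence_structure_def)
qed

section \<open>Dependences, and adjacency as an invariant of Markov equivalence\<close>

lemma adjacent_dependent:
  assumes "adjacent G x y"
  shows "({x}, {y}, c) \<notin> independence_structure G"
proof -
  obtain k where "has_step G x k y" using assms by (auto simp: adjacent_def)
  then have "active_path G c [x, y] [k]"
    by (auto simp: active_path_def is_path_def)
  then show ?thesis unfolding independence_structure_def by force
qed

lemma transmitting_dependent:
  assumes "has_step G x k y" "has_step G y l z" "\<not> (k \<in> {Fwd, Dash} \<and> l \<in> {Bwd, Dash})"
    "y \<notin> c" "x \<noteq> y" "y \<noteq> z"
  shows "({x}, {z}, c) \<notin> independence_structure G"
proof -
  have "active_path G c [x, y, z] [k, l]"
    using assms by (auto simp: active_path_def is_path_def collision_at_def less_Suc_eq)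
  then show ?thesis unfolding independence_structure_def by force
qed

text \<open>At most one of two nodes is strictly before the other, so the separator works from at
  least one side. The disjunction avoids an appeal to symmetry of independence.\<close>

lemma independent_if_nonadjacent:
  assumes "regression_graph G" "x \<in> nodes G" "y \<in> nodes G" "x \<noteq> y" "\<not> adjacent G x y"
  shows "\<exists>c. ({x}, {y}, c) \<in> independence_structure G \<or> ({y}, {x}, c) \<in> independence_structure G"
proof (cases "(x, y) \<in> strictly_before G")
  case True
  then have "(y, x) \<notin> strictly_before G"
    using strictly_before_not_after[OF assms(1)] strictly_beforeD by metis
  then show ?thesis
    using separator_independence[OF assms(1)] assms adjacent_sym by metis
next
  case False
  then show ?thesis using separator_independence assms by metis
qed

text \<open>Adjacency can be read off the independence structure: no set separates adjacent nodes,
  while some set separates nonadjacent ones.\<close>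

lemma markov_equivalent_adjacent:
  assumes "regression_graph G" "regression_graph H" "markov_equivalent G H"
    and "x \<in> nodes G" "y \<in> nodes G" "x \<noteq> y"
  shows "adjacent G x y \<longleftrightarrow> adjacent H x y"
proof -
  have "nodes G = nodes H" "independence_structure G = independence_structure H"
    using assms(3) by (auto simp: markov_equivalent_def)
  with assms show ?thesis
    by (metis independent_if_nonadjacent adjacent_dependent adjacent_sym)
qed

section \<open>V configurations under Markov equivalence\<close>

lemma forms_V_nonadjacent:
  assumes V: "forms_V G i j k" and "adjacent G i j" "adjacent G j k"
  shows "\<not> adjacent G i k"
proof
  assume "adjacent G i k"
  let ?S = "{i, j, k}"
  let ?A = "arrows G \<inter> ?S \<times> ?S" and ?B = "dashed G \<inter> Pow ?S" and ?F = "full G \<inter> Pow ?S"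
  \<comment> \<open>Forgetting arrow directions turns every edge into a node pair, so
    \<open>card ?E\<close> is at most \<open>edges_within\<close>, which is 2. A third adjacency
    would put three different pairs into \<open>?E\<close>.\<close>
  let ?E = "(\<lambda>(x, y). {x, y}) ` ?A \<union> ?B \<union> ?F"
  have fin: "finite ?A" "finite ?B" "finite ?F" by auto
  have E: "{x, y} \<in> ?E" if adj: "adjacent G x y" and "x \<in> ?S" "y \<in> ?S" for x y
  proof -
    from adj obtain s where s: "has_step G x s y" by (auto simp: adjacent_def)
    show ?thesis
    proof (cases s)
      case Fwd
      then have "(x, y) \<in> ?A" using s that by (intro IntI SigmaI) simp_all
      then show ?thesis by (metis (mono_tags, lifting) UnI1 case_prod_conv image_eqI)
    next
      case Bwd
      then have "(y, x) \<in> ?A" using s that by (intro IntI SigmaI) simp_all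
      then have "{y, x} \<in> ?E" by (metis (mono_tags, lifting) UnI1 case_prod_conv image_eqI)
      then show ?thesis by (simp add: insert_commute)
    next
      case Dash
      then have "{x, y} \<in> ?B" using s that by simp
      then show ?thesis by blast
    next
      case Line
      then have "{x, y} \<in> ?F" using s that by simp
      then show ?thesis by blast
    qed
  qed
  have "{{i, j}, {j, k}, {i, k}} \<subseteq> ?E"
    using E assms(2,3) \<open>adjacent G i k\<close> by auto
  moreover have "card {{i, j}, {j, k}, {i, k}} = 3"
    using V by (auto simp: forms_V_def card_insert_if doubleton_eq_iff split: if_splits)
  ultimately have "3 \<le> card ?E"
    using fin by (metis card_mono finite_UnI finite_imageI)
  also have "\<dots> \<le> card ((\<lambda>(x, y). {x, y}) ` ?A) + card ?B + card ?F"
    by (meson add_le_cancel_right card_Un_le le_trans)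
  also have "\<dots> \<le> card ?A + card ?B + card ?F"
    using card_image_le[OF fin(1)] by simp
  finally show False
    using V by (simp add: forms_V_def edges_within_def)
qed

lemma forms_V_distinct:
  assumes "forms_V G i j k"
  shows "i \<noteq> j" "j \<noteq> k" "i \<noteq> k" "i \<in> nodes G" "j \<in> nodes G" "k \<in> nodes G"
  using assms by (auto simp: forms_V_def card_insert_if split: if_splits)

lemma directed_acyclic_graph_step:
  assumes "directed_acyclic_graph D" "adjacent D x y"
  obtains "(x, y) \<in> arrows D" | "(y, x) \<in> arrows D"
proof -
  from assms(2) obtain k where "has_step D x k y" by (auto simp: adjacent_def)
  then show ?thesis
    using assms(1) that by (cases k) (auto simp: directed_acyclic_graph_def)
qed

text \<open>The separator of \<open>c\<close> and \<open>a\<close> in \<open>G\<close> omits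
  \<open>b\<close>. If \<open>D\<close> had the arrow from \<open>b\<close> to \<open>c\<close>,
  then \<open>b\<close> would transmit in \<open>D\<close>, and the path over \<open>b\<close> would
  be active given that set.\<close>

lemma collision_V_arrow:
  assumes G: "regression_graph G" and D: "directed_acyclic_graph D" and eq: "markov_equivalent G D"
    and V: "forms_V G a b c" and ab: "(a, b) \<in> arrows G \<or> {a, b} \<in> dashed G"
    and bc: "{b, c} \<in> dashed G"
  shows "(c, b) \<in> arrows D"
proof (rule ccontr)
  assume no: "(c, b) \<notin> arrows D"
  note d = forms_V_distinct[OF V]
  note DR = directed_acyclic_graph_regression[OF D]
  have S: "summary_graph G" using G by (simp add: regression_graph_def)
  have adj: "adjacent G a b" "adjacent G b c"
    using ab bc unfolding adjacent_def by (metis has_step.simps(1,3))+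
  then have adjD: "adjacent D a b" "adjacent D b c"
    using markov_equivalent_adjacent[OF G DR eq] d by auto
  have nadj: "\<not> adjacent G c a"
    using forms_V_nonadjacent[OF V adj] adjacent_sym by metis
  \<comment> \<open>The dashed line can be walked both ways, so \<open>b\<close> is not strictly
    before \<open>c\<close>; moreover \<open>a\<close> reaches \<open>c\<close> through
    \<open>b\<close>, so \<open>c\<close> is not strictly before \<open>a\<close>.\<close>
  have cb: "(c, b) \<in> (forward G)\<^sup>*" "(b, c) \<in> (forward G)\<^sup>*"
    using bc by (auto intro!: r_into_rtrancl forwardI[where k = Dash] simp: insert_commute)
  have "(a, b) \<in> forward G"
    using ab by (auto intro: forwardI[where k = Fwd] forwardI[where k = Dash])
  then have "(a, c) \<in> (forward G)\<^sup>*" using cb(2) by (rule converse_rtrancl_into_rtrancl)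
  then have "(c, a) \<notin> strictly_before G"
    using strictly_before_not_after[OF G] by blast
  then have ind: "({c}, {a}, separator G c a) \<in> independence_structure D"
    using separator_independence[OF G _ _ _ nadj] d eq by (auto simp: markov_equivalent_def)
  have "b \<notin> separator G c a"
    using cb(1) strictly_before_not_after[OF G] summary_graphD(2)[OF S] summary_graphD(5)[OF S bc]
    by (auto simp: separator_def)
  moreover have "has_step D c Bwd b"
    using directed_acyclic_graph_step[OF D adjD(2)] no by auto
  moreover obtain l where "has_step D b l a"
    using adjacent_sym[OF adjD(1)] by (auto simp: adjacent_def)
  ultimately show False
    using transmitting_dependent[of D c Bwd b l a] d ind by auto
qed

text \<open>The roles are exchanged: the separator is taken in \<open>D\<close>, where it omits the
  common child \<open>j\<close>, while in \<open>G\<close> the node \<open>j\<close> transmits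
  outside it.\<close>

lemma transmitting_V_no_collision:
  assumes D: "directed_acyclic_graph D" and eq: "markov_equivalent G D"
    and G: "regression_graph G" and V: "forms_V G i j k"
    and full: "{i, j} \<in> full G" "{j, k} \<in> full G"
    and arr: "(i, j) \<in> arrows D" "(k, j) \<in> arrows D"
  shows False
proof -
  note d = forms_V_distinct[OF V]
  note DR = directed_acyclic_graph_regression[OF D]
  have S: "summary_graph D" using D by (simp add: directed_acyclic_graph_def)
  have nd: "nodes G = nodes D" using eq by (simp add: markov_equivalent_def)
  have "\<not> adjacent G i k"
    using full by (intro forms_V_nonadjacent[OF V]) (metis adjacent_def has_step.simps(4))+
  then have nadj: "\<not> adjacent D i k" "\<not> adjacent D k i"
    using markov_equivalent_adjacent[OF G DR eq] d adjacent_sym by metis+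
  \<comment> \<open>The parts u and v here are those of \<open>D\<close>: although \<open>j\<close>
    lies in v of \<open>G\<close>, it receives an arrow in \<open>D\<close> and so lies in u of
    \<open>D\<close>.\<close>
  have j: "j \<notin> separator D x y" if "(x, j) \<in> arrows D" for x y
  proof -
    have "(x, j) \<in> (forward D)\<^sup>*" using that arrows_subset_forward by blast
    then show ?thesis
      using strictly_before_not_after[OF DR] summary_graphD(2)[OF S] summary_graphD(4)[OF S that]
      by (auto simp: separator_def)
  qed
  have dep: "({i}, {k}, separator D i k) \<notin> independence_structure G"
    "({k}, {i}, separator D k i) \<notin> independence_structure G"
    using transmitting_dependent[of G i Line j Line k] transmitting_dependent[of G k Line j Line i]
      full d j[OF arr(1)] j[OF arr(2)] by (auto simp: insert_commute)
  \<comment> \<open>It is open which end is strictly before the other in \<open>D\<close>, hence the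
    dependences in both orders.\<close>
  have "(i, k) \<notin> strictly_before D \<or> (k, i) \<notin> strictly_before D"
    using strictly_before_not_after[OF DR] strictly_beforeD by metis
  then show False
    using separator_independence[OF DR] nadj d nd dep eq by (auto simp: markov_equivalent_def)
qed

section \<open>The two forbidden configurations\<close>

lemma chordless_cycle_full_impossible:
  assumes G: "regression_graph G" and D: "directed_acyclic_graph D" and eq: "markov_equivalent G D"
    and cyc: "chordless_cycle G ns ks" and v: "set ns \<subseteq> part_v G"
  shows False
proof -
  let ?n = "length ks"
  have S: "summary_graph G" "summary_graph D"
    using G D by (auto simp: regression_graph_def directed_acyclic_graph_def)
  from cyc have len: "length ns = Suc ?n" "ks \<noteq> []"
    and steps: "\<And>i. i < ?n \<Longrightarrow> has_step G (ns ! i) (ks ! i) (ns ! Suc i)"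
    and V: "\<And>j. 0 < j \<Longrightarrow> j < ?n \<Longrightarrow> forms_V G (ns ! (j - 1)) (ns ! j) (ns ! Suc j)"
    and V0: "forms_V G (ns ! (?n - 1)) (ns ! 0) (ns ! 1)"
    and closed: "hd ns = last ns"
    by (auto simp: chordless_cycle_def is_cycle_def chordless_path_def is_path_def)
  have closed: "ns ! ?n = ns ! 0"
    using closed len by (metis diff_Suc_1 hd_conv_nth last_conv_nth length_0_conv nat.distinct(1))
  \<comment> \<open>Arrowheads and dashed lines occur only at nodes of u, so an edge between two
    nodes of v is a full line.\<close>
  have full: "{ns ! i, ns ! Suc i} \<in> full G" if "i < ?n" for i
  proof -
    have "ns ! i \<in> part_v G" "ns ! Suc i \<in> part_v G"
      using v len that nth_mem[of _ ns] by auto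
    then show ?thesis
      using steps[OF that] summary_graphD(2,4,5)[OF S(1)]
      by (cases "ks ! i") (simp_all, (metis disjoint_iff)+)
  qed
  have "acyclic (arrows D)" "finite (arrows D)"
    using acyclic_arrows[OF S(2)] S(2)
    by (auto simp: summary_graph_def nodes_def elim!: finite_subset)
  \<comment> \<open>A minimal element for the converse of the arrows is a sink \<open>x\<close> of
    \<open>D\<close> among the cycle nodes; both its neighbours on the cycle must point to
    it.\<close>
  then have "wf ((arrows D)\<inverse>)" by (rule finite_acyclic_wf_converse[rotated])
  then obtain x where x: "x \<in> set ns" "\<And>y. (x, y) \<in> arrows D \<Longrightarrow> y \<notin> set ns"
    using len(1) by (metis converse_iff length_0_conv list.set_intros(1) nat.distinct(1) neq_Nil_conv wfE_min)
  have sink: False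
    if "x = q" "forms_V G p q r" "{p, q} \<in> full G" "{q, r} \<in> full G" "p \<in> set ns" "r \<in> set ns" for p q r
  proof -
    note d = forms_V_distinct[OF that(2)]
    have "adjacent G p q" "adjacent G r q"
      using that(3,4) by (auto simp: adjacent_def insert_commute intro!: exI[of _ Line])
    then have "adjacent D p q" "adjacent D r q"
      using markov_equivalent_adjacent[OF G directed_acyclic_graph_regression[OF D] eq] d by auto
    then have "(p, q) \<in> arrows D" "(r, q) \<in> arrows D"
      using x that(1,5,6) directed_acyclic_graph_step[OF D] by metis+
    then show False
      using transmitting_V_no_collision[OF D eq G that(2-4)] by blast
  qed
  obtain j where "j \<le> ?n" "x = ns ! j"
    using x(1) len by (metis in_set_conv_nth less_Suc_eq_le)
  \<comment> \<open>Index \<open>?n\<close> repeats index 0, whose neighbours on the cycle are at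
    \<open>?n - 1\<close> and 1; that V is \<open>V0\<close>.\<close>
  then consider "0 < j" "j < ?n" "x = ns ! j" | "x = ns ! 0"
    using closed by (metis le_neq_implies_less neq0_conv)
  then show False
  proof cases
    case 1
    have "{ns ! (j - 1), ns ! j} \<in> full G" using full[of "j - 1"] 1 by simp
    then show ?thesis
      using sink[OF 1(3) V[OF 1(1,2)]] full[OF 1(2)] 1 len by simp
  next
    case 2
    have "{ns ! (?n - 1), ns ! 0} \<in> full G" using full[of "?n - 1"] len(2) closed by simp
    then show ?thesis
      using sink[OF 2 V0] full[of 0] len by simp
  qed
qed

lemma chordless_collision_path_impossible:
  assumes G: "regression_graph G" and D: "directed_acyclic_graph D" and eq: "markov_equivalent G D"
    and coll: "collision_path G ns ks" and chl: "chordless_path G ns ks" and len: "length ns = 4"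
  shows False
proof -
  have n: "length ks = 3"
    and steps: "\<And>i. i < 3 \<Longrightarrow> has_step G (ns ! i) (ks ! i) (ns ! Suc i)"
    and c: "\<And>j. j \<in> {0<..<3} \<Longrightarrow> collision_at ks j"
    and V: "\<And>j. j \<in> {0<..<3} \<Longrightarrow> forms_V G (ns ! (j - 1)) (ns ! j) (ns ! Suc j)"
    using coll chl len by (auto simp: collision_path_def chordless_path_def is_path_def)
  have V1: "forms_V G (ns ! 0) (ns ! 1) (ns ! 2)" and V2: "forms_V G (ns ! 1) (ns ! 2) (ns ! 3)"
    using V[of 1] V[of 2] by (simp_all add: numeral_eq_Suc)
  \<comment> \<open>Reversed, so that the shared middle edge is the second edge of both Vs.\<close>
  have V2: "forms_V G (ns ! 3) (ns ! 2) (ns ! 1)"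
    using V2 by (simp add: forms_V_def insert_commute)
  \<comment> \<open>The middle edge takes part in both collisions, from opposite ends, and only a
    dashed line can do so.\<close>
  have k: "ks ! 0 \<in> {Fwd, Dash}" "ks ! 1 = Dash" "ks ! 2 \<in> {Bwd, Dash}"
    using c[of 1] c[of 2] by (auto simp: collision_at_def)
  have "(ns ! 0, ns ! 1) \<in> arrows G \<or> {ns ! 0, ns ! 1} \<in> dashed G"
    using steps[of 0] k(1) by auto
  moreover have "{ns ! 1, ns ! 2} \<in> dashed G" "{ns ! 2, ns ! 1} \<in> dashed G"
    using steps[of 1] k(2) by (auto simp: numeral_2_eq_2 insert_commute)
  moreover have "(ns ! 3, ns ! 2) \<in> arrows G \<or> {ns ! 3, ns ! 2} \<in> dashed G"
    using steps[of 2] k(3) by (auto simp: insert_commute numeral_3_eq_3)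
  \<comment> \<open>One application from each end of the path orients the middle edge in opposite
    directions.\<close>
  ultimately have "(ns ! 2, ns ! 1) \<in> arrows D" "(ns ! 1, ns ! 2) \<in> arrows D"
    using collision_V_arrow[OF G D eq] V1 V2 by blast+
  then show False
    using acyclic_arrows[of D] D
    by (meson acyclic_def directed_acyclic_graph_def r_into_trancl trancl_trans)
qed

theorem proposition2:
  fixes G :: "'a summary_graph"
  assumes "regression_graph G"
    and "(\<exists>ns ks. collision_path G ns ks \<and> chordless_path G ns ks \<and>
            length ns = 4 \<and> distinct ns) \<or>
         (\<exists>ns ks. chordless_cycle G ns ks \<and> card (set ns) \<ge> 4 \<and> set ns \<subseteq> part_v G)"
  shows "\<not> (\<exists>D :: 'a summary_graph.
            directed_acyclic_graph D \<and> nodes D = nodes G \<and> markov_equivalent G D)"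
  using assms chordless_collision_path_impossible chordless_cycle_full_impossible by blast

end
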